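(* Let $G=(V,E)$ be a graph, $k\in\mathbb{Z}_{>0}$ and $\ell:\{1,\dots,k\}\to\mathbb{Z}_{>0}$. There exists a packing of $k$ spanning forests in $G$ with $\ell(1),\dots,\ell(k)$ connected components, respectively, if and only if both of the following hold: $$|V|\ge\ell(i)\quad\text{for every }1\le i\le k,$$ $$\sum_{i=1}^k\min\{\ell(i),|\mathcal{P}|\}+e_E(\mathcal{P})\ \ge\ k|\mathcal{P}|\quad\text{for every partition }\mathcal{P}\text{ of }V.$$
   Context: Graphs are finite and undirected with nonempty vertex set; parallel edges are allowed. For a partition $\mathcal{P}$ of $V$, $e_E(\mathcal{P})$ is the number of edges in $E$ that enter some member of $\mathcal{P}$, i.e. whose end-vertices lie in two different members of $\mathcal{P}$. A spanning forest of $G$ is a cycle-free subgraph of $G$ with vertex set $V$ (it need not be maximal; isolated vertices count as connected components). A packing of $k$ spanning forests is a collection of $k$ pairwise edge-disjoint spanning forests of $G$. *)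

theory Defs
  imports Main "HOL-Library.Disjoint_Sets"
begin

text \<open>
  Multigraphs: edges are abstract objects and \<^term>\<open>ends e\<close> is the set of end-vertices of \<open>e\<close>.
  Distinct edges may have the same ends (parallel edges); an edge with a single
  end-vertex is a loop.
\<close>

locale multigraph =
  fixes V :: "'v set" and E :: "'e set" and ends :: "'e \<Rightarrow> 'v set"
  assumes finite_verts: "finite V"
    and verts_nonempty: "V \<noteq> {}"
    and finite_edges: "finite E"
    and ends_subset: "e \<in> E \<Longrightarrow> ends e \<subseteq> V"
    and card_ends: "e \<in> E \<Longrightarrow> card (ends e) = 1 \<or> card (ends e) = 2"

definition enters :: "('e \<Rightarrow> 'v set) \<Rightarrow> 'e \<Rightarrow> 'v set \<Rightarrow> bool" where
  "enters ends e X \<longleftrightarrow> (\<exists>u v. ends e = {u, v} \<and> u \<in> X \<and> v \<notin> X)"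

definition num_entering :: "'e set \<Rightarrow> ('e \<Rightarrow> 'v set) \<Rightarrow> 'v set set \<Rightarrow> nat" where
  "num_entering E ends P = card {e \<in> E. \<exists>X\<in>P. enters ends e X}"

text \<open>
  A cycle visits the distinct vertices \<open>vs\<close> in cyclic order along the distinct edges \<open>es\<close>.
  A loop is a cycle of length 1, and two parallel edges form a cycle of length 2; for
  length 2, distinctness of \<open>es\<close> is what excludes going back along the same edge.
\<close>

definition is_cycle :: "'e set \<Rightarrow> ('e \<Rightarrow> 'v set) \<Rightarrow> 'v list \<Rightarrow> 'e list \<Rightarrow> bool" where
  "is_cycle F ends vs es \<longleftrightarrow>
     es \<noteq> [] \<and> length vs = length es \<and> distinct vs \<and> distinct es \<and> set es \<subseteq> F \<and>
     (\<forall>i < length es. ends (es ! i) = {vs ! i, vs ! (Suc i mod length es)})"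

text \<open>
  A subgraph with vertex set \<open>V\<close> is determined by its edge set, so spanning forests
  are represented by edge sets \<open>F \<subseteq> E\<close>.
\<close>

definition spanning_forest :: "'e set \<Rightarrow> ('e \<Rightarrow> 'v set) \<Rightarrow> 'e set \<Rightarrow> bool" where
  "spanning_forest E ends F \<longleftrightarrow> F \<subseteq> E \<and> (\<nexists>vs es. is_cycle F ends vs es)"

definition adjacency :: "'e set \<Rightarrow> ('e \<Rightarrow> 'v set) \<Rightarrow> ('v \<times> 'v) set" where
  "adjacency F ends = {(u, v). \<exists>e\<in>F. ends e = {u, v}}"

definition connected_components :: "'v set \<Rightarrow> 'e set \<Rightarrow> ('e \<Rightarrow> 'v set) \<Rightarrow> 'v set set" where
  "connected_components V F ends = V // Restr ((adjacency F ends)\<^sup>*) V"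

definition forest_packing ::
  "'v set \<Rightarrow> 'e set \<Rightarrow> ('e \<Rightarrow> 'v set) \<Rightarrow> nat \<Rightarrow> (nat \<Rightarrow> nat) \<Rightarrow> (nat \<Rightarrow> 'e set) \<Rightarrow> bool" where
  "forest_packing V E ends k l F \<longleftrightarrow>
     (\<forall>i\<in>{1..k}. spanning_forest E ends (F i) \<and>
                  card (connected_components V (F i) ends) = l i) \<and>
     disjoint_family_on F {1..k}"

end

theory Submission
  imports Defs
begin

text \<open>
  Write \<open>c(J)\<close> for the number of connected components of \<open>(V, J)\<close>.  An edge set \<open>J\<close> contains a
  spanning forest with exactly \<open>\<ell>\<close> components iff \<open>c(J) \<le> \<ell> \<le> |V|\<close>: a minimal
  \<open>F \<subseteq> J\<close> with \<open>c(F) \<le> \<ell>\<close> has no cycle, since deleting an edge of a cycle does not change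
  \<open>c\<close>, and \<open>c(F) = \<ell>\<close>, since deleting any edge raises \<open>c\<close> by at most one.

  Necessity is then a count in a single forest \<open>F\<close> with \<open>\<ell>\<close> components.  Without the edges
  that enter \<open>\<P>\<close>, the forest has at least \<open>|\<P>|\<close> components, and putting back one of these edges
  lowers the number of components by at most one.  So at least
  \<open>|\<P>| - min {\<ell>, |\<P>|}\<close> edges of \<open>F\<close> enter \<open>\<P>\<close>.  Adding this up over the disjoint forests
  gives the inequality.

  For sufficiency, it is enough to find disjoint sets \<open>J\<^sub>1, \<dots>, J\<^sub>k \<subseteq> E\<close> with
  \<open>c(J\<^sub>i) \<le> \<ell>(i)\<close>.  Put \<open>f\<^sub>i(J) = - max {\<ell>(i), c(J)}\<close>.  Up to the constant \<open>|V|\<close> this is the rank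
  function of a truncated graphic matroid, so it is monotone and submodular, and it never exceeds
  \<open>-\<ell>(i)\<close>.  Hence \<open>c(J\<^sub>i) \<le> \<ell>(i)\<close> for all \<open>i\<close> as soon as
  \<open>f\<^sub>1(J\<^sub>1) + \<dots> + f\<^sub>k(J\<^sub>k) \<ge> - (\<ell>(1) + \<dots> + \<ell>(k))\<close>.  The partition condition, applied to the
  components of \<open>(V, J)\<close>, which are entered by no edge of \<open>J\<close>, gives
  \<open>|J| \<le> f\<^sub>1(J) + \<dots> + f\<^sub>k(J) + d\<close> for every \<open>J \<subseteq> E\<close>, where
  \<open>d = |E| + \<ell>(1) + \<dots> + \<ell>(k)\<close>.  This is a Rado condition in which every edge may
  use all \<open>k\<close> colours.  By submodularity, an edge with two colours can always give up one of them
  without violating the condition (lemma \<open>rado_thinning\<close>).  So in a minimal choice of colours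
  satisfying it the colour classes are disjoint, and the condition for \<open>J = E\<close> is the bound above.
\<close>

section \<open>Rado's theorem for monotone submodular functions\<close>

text \<open>
  This is Rado's argument in a deficiency form.  Take \<open>R'\<close> minimal.  If \<open>e\<close> were related to both
  \<open>x\<close> and \<open>y\<close>, then dropping either pair would violate the condition, for sets \<open>J\<close> and \<open>K\<close> say,
  both containing \<open>e\<close>.  The two thinned relations over \<open>J\<close> and \<open>K\<close> together still cover the part
  of \<open>R'\<close> over \<open>J \<union> K\<close>, and their intersection covers the part over \<open>(J \<inter> K) - {e}\<close>, so
  submodularity contradicts the condition for these two sets.
\<close>

lemma rado_thinning:
  fixes g :: "('e \<times> 'i) set \<Rightarrow> int" and d :: int
  assumes "finite E" and "finite R"
    and mono: "\<And>A B. A \<subseteq> B \<Longrightarrow> B \<subseteq> R \<Longrightarrow> g A \<le> g B"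
    and submod: "\<And>A B. A \<subseteq> R \<Longrightarrow> B \<subseteq> R \<Longrightarrow> g (A \<union> B) + g (A \<inter> B) \<le> g A + g B"
    and rado: "\<And>J. J \<subseteq> E \<Longrightarrow> int (card J) \<le> g (R \<inter> J \<times> UNIV) + d"
  obtains R' where "R' \<subseteq> R" and "single_valued R'"
    and "\<And>J. J \<subseteq> E \<Longrightarrow> int (card J) \<le> g (R' \<inter> J \<times> UNIV) + d"
proof -
  define good where
    "good S \<longleftrightarrow> S \<subseteq> R \<and> (\<forall>J\<subseteq>E. int (card J) \<le> g (S \<inter> J \<times> UNIV) + d)" for S
  have "good R" using rado by (simp add: good_def)
  moreover have "finite {S. good S}"
    using \<open>finite R\<close> by (auto simp: good_def intro: finite_subset[of _ "Pow R"])
  ultimately obtain S where S: "good S" and min: "\<And>T. good T \<Longrightarrow> T \<subseteq> S \<Longrightarrow> T = S"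
    using finite_has_minimal[of "{S. good S}"] by auto
  have SR: "S \<subseteq> R" using S by (simp add: good_def)
  have violated: "\<exists>J\<subseteq>E. e \<in> J \<and> g ((S - {(e, i)}) \<inter> J \<times> UNIV) + d < int (card J)"
    if "(e, i) \<in> S" for e i
  proof -
    have "\<not> good (S - {(e, i)})" using min[of "S - {(e, i)}"] that by auto
    then obtain J where J: "J \<subseteq> E" "g ((S - {(e, i)}) \<inter> J \<times> UNIV) + d < int (card J)"
      using SR by (auto simp: good_def not_le)
    have "e \<in> J"
    proof (rule ccontr)
      assume "e \<notin> J"
      then have "(S - {(e, i)}) \<inter> J \<times> UNIV = S \<inter> J \<times> UNIV" by auto
      with J S show False unfolding good_def by (metis not_le)
    qed
    with J show ?thesis by blast
  qed
  have "single_valued S"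
  proof (rule single_valuedI, rule ccontr)
    fix e x y assume ex: "(e, x) \<in> S" and ey: "(e, y) \<in> S" and "x \<noteq> y"
    obtain J where J: "J \<subseteq> E" "e \<in> J" "g ((S - {(e, x)}) \<inter> J \<times> UNIV) + d < int (card J)"
      using violated[OF ex] by blast
    obtain K where K: "K \<subseteq> E" "e \<in> K" "g ((S - {(e, y)}) \<inter> K \<times> UNIV) + d < int (card K)"
      using violated[OF ey] by blast
    let ?A = "(S - {(e, x)}) \<inter> J \<times> UNIV" and ?B = "(S - {(e, y)}) \<inter> K \<times> UNIV"
    have fin: "finite J" "finite K" using J(1) K(1) \<open>finite E\<close> finite_subset by blast+
    have "?A \<union> ?B = S \<inter> (J \<union> K) \<times> UNIV"
      using ex ey J(2) K(2) \<open>x \<noteq> y\<close> by auto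
    then have un: "int (card (J \<union> K)) \<le> g (?A \<union> ?B) + d"
      using S J(1) K(1) by (simp add: good_def)
    have "g (S \<inter> (J \<inter> K - {e}) \<times> UNIV) \<le> g (?A \<inter> ?B)"
      using SR by (intro mono) auto
    moreover have "J \<inter> K - {e} \<subseteq> E" using J(1) by auto
    then have "int (card (J \<inter> K - {e})) \<le> g (S \<inter> (J \<inter> K - {e}) \<times> UNIV) + d"
      using S unfolding good_def by blast
    moreover have "int (card (J \<inter> K - {e})) = int (card (J \<inter> K)) - 1"
      using J(2) K(2) fin card_Suc_Diff1[of "J \<inter> K" e] by simp
    ultimately have int: "int (card (J \<inter> K)) - 1 \<le> g (?A \<inter> ?B) + d" by linarith
    have "g (?A \<union> ?B) + g (?A \<inter> ?B) \<le> g ?A + g ?B"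
      using SR by (intro submod) auto
    moreover have "card (J \<union> K) + card (J \<inter> K) = card J + card K"
      using card_Un_Int[OF fin] by simp
    ultimately show False using un int J(3) K(3) by linarith
  qed
  with S that show thesis unfolding good_def by blast
qed

text \<open>
  This is the matroid union theorem, with monotone submodular functions in place of rank functions.
  It follows from the thinning of the full relation \<open>E \<times> I\<close>: the set function that adds up the
  values of \<open>f i\<close> on the colour classes of a set of (element, colour) pairs is again monotone and
  submodular.
\<close>

lemma submodular_colouring:
  fixes f :: "'i \<Rightarrow> 'e set \<Rightarrow> int" and d :: int
  assumes "finite E" and "finite I"
    and mono: "\<And>i A B. i \<in> I \<Longrightarrow> A \<subseteq> B \<Longrightarrow> B \<subseteq> E \<Longrightarrow> f i A \<le> f i B"
    and submod: "\<And>i A B. i \<in> I \<Longrightarrow> A \<subseteq> E \<Longrightarrow> B \<subseteq> E \<Longrightarrow>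
      f i (A \<union> B) + f i (A \<inter> B) \<le> f i A + f i B"
    and rado: "\<And>J. J \<subseteq> E \<Longrightarrow> int (card J) \<le> (\<Sum>i\<in>I. f i J) + d"
  obtains C where "\<forall>i. C i \<subseteq> E" and "disjoint_family_on C I"
    and "int (card E) \<le> (\<Sum>i\<in>I. f i (C i)) + d"
proof -
  define cls where "cls S i = {e. (e, i) \<in> S}" for S :: "('e \<times> 'i) set" and i
  define g where "g S = (\<Sum>i\<in>I. f i (cls S i))" for S
  have cls_E: "cls S i \<subseteq> E" if "S \<subseteq> E \<times> I" for S i using that by (auto simp: cls_def)
  have cls_Un: "cls (A \<union> B) i = cls A i \<union> cls B i"
    and cls_Int: "cls (A \<inter> B) i = cls A i \<inter> cls B i" for A B i
    by (auto simp: cls_def)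
  have rado': "int (card J) \<le> g ((E \<times> I) \<inter> J \<times> UNIV) + d" if "J \<subseteq> E" for J
  proof -
    have "cls ((E \<times> I) \<inter> J \<times> UNIV) i = J" if "i \<in> I" for i
      using that \<open>J \<subseteq> E\<close> by (auto simp: cls_def)
    then show ?thesis using rado[OF that] by (simp add: g_def)
  qed
  obtain R where R: "R \<subseteq> E \<times> I" "single_valued R"
    and bound: "\<And>J. J \<subseteq> E \<Longrightarrow> int (card J) \<le> g (R \<inter> J \<times> UNIV) + d"
  proof (rule rado_thinning[of E "E \<times> I" g d])
    show "finite (E \<times> I)" using assms by simp
    show "g A \<le> g B" if "A \<subseteq> B" "B \<subseteq> E \<times> I" for A B
      unfolding g_def using that by (intro sum_mono mono cls_E) (auto simp: cls_def)
    show "g (A \<union> B) + g (A \<inter> B) \<le> g A + g B" if "A \<subseteq> E \<times> I" "B \<subseteq> E \<times> I" for A B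
      unfolding g_def sum.distrib[symmetric] cls_Un cls_Int
      using that by (intro sum_mono submod cls_E)
  qed (use \<open>finite E\<close> rado' in auto)
  have "R \<inter> E \<times> UNIV = R" using R(1) by auto
  then have "int (card E) \<le> (\<Sum>i\<in>I. f i (cls R i)) + d"
    using bound[of E] by (simp add: g_def)
  moreover have "disjoint_family_on (cls R) I"
    using R(2) by (auto simp: disjoint_family_on_def cls_def single_valued_def)
  ultimately show thesis using that[of "cls R"] cls_E[OF R(1)] by blast
qed

text \<open>
  Truncating a monotone submodular function keeps it submodular.  The statement is in terms of
  the negative \<open>h\<close> of such a function, with values at \<open>A\<close>, \<open>B\<close>, their union and their
  intersection, because counting components gives an antitone supermodular function.
\<close>

lemma supermodular_max:
  fixes hA hB hU hI m :: int
  assumes "hA + hB \<le> hU + hI" and "hU \<le> hA" "hU \<le> hB" "hA \<le> hI" "hB \<le> hI"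
  shows "max m hA + max m hB \<le> max m hU + max m hI"
  using assms by linarith

section \<open>Merging classes of an equivalence relation\<close>

lemma card_quotient_merge:
  assumes V: "finite V" and r: "equiv V r" and u: "u \<in> V" and v: "v \<in> V" and uv: "(u, v) \<notin> r"
    and r': "r' = r \<union> r `` {u} \<times> r `` {v} \<union> r `` {v} \<times> r `` {u}"
  shows "card (V // r) = Suc (card (V // r'))"
proof -
  let ?U = "r `` {u}" and ?W = "r `` {v}"
  have sym: "(a, b) \<in> r \<Longrightarrow> (b, a) \<in> r" for a b using r by (meson equivE symE)
  have trans: "(a, b) \<in> r \<Longrightarrow> (b, c) \<in> r \<Longrightarrow> (a, c) \<in> r" for a b c using r by (meson equivE transE)
  have refl: "a \<in> V \<Longrightarrow> (a, a) \<in> r" for a using r by (meson equivE refl_onD)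
  have cls: "r' `` {a} = (if a \<in> ?U \<union> ?W then ?U \<union> ?W else r `` {a})" for a
  proof -
    have "a \<in> ?U \<Longrightarrow> r `` {a} = ?U" "a \<in> ?W \<Longrightarrow> r `` {a} = ?W"
      using sym trans by blast+
    moreover have "\<not> (a \<in> ?U \<and> a \<in> ?W)" using uv sym trans by blast
    ultimately show ?thesis unfolding r' by auto
  qed
  have other: "a \<notin> ?U \<union> ?W \<longleftrightarrow> r `` {a} \<noteq> ?U \<and> r `` {a} \<noteq> ?W" if "a \<in> V" for a
    using that refl sym trans u v by blast
  have "V // r' = insert (?U \<union> ?W) (V // r - {?U, ?W})"
  proof (intro set_eqI iffI)
    fix X assume "X \<in> V // r'"
    then obtain a where a: "a \<in> V" "X = r' `` {a}" by (auto simp: quotient_def)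
    show "X \<in> insert (?U \<union> ?W) (V // r - {?U, ?W})"
    proof (cases "a \<in> ?U \<union> ?W")
      case True then show ?thesis using a cls[of a] by simp
    next
      case False
      then show ?thesis using a cls[of a] other[of a] by (auto intro: quotientI)
    qed
  next
    fix X assume "X \<in> insert (?U \<union> ?W) (V // r - {?U, ?W})"
    then consider "X = ?U \<union> ?W" | a where "a \<in> V" "X = r `` {a}" "X \<noteq> ?U" "X \<noteq> ?W"
      by (auto simp: quotient_def)
    then show "X \<in> V // r'"
    proof cases
      case 1
      then have "X = r' `` {u}" using cls[of u] refl[OF u] by auto
      then show ?thesis using u by (auto intro: quotientI)
    next
      case 2
      then have "X = r' `` {a}" using cls[of a] other[of a] by auto
      then show ?thesis using 2 by (auto intro: quotientI)
    qed
  qed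
  moreover have "?U \<union> ?W \<notin> V // r"
  proof
    assume "?U \<union> ?W \<in> V // r"
    then have "(u, v) \<in> r"
    proof (rule in_quotient_imp_in_rel[OF r])
      show "{u, v} \<subseteq> ?U \<union> ?W" using refl u v by blast
    qed
    then show False using uv by simp
  qed
  moreover have "finite (V // r)"
    using V r by (simp add: finite_quotient equiv_type)
  moreover have "?U \<noteq> ?W" using refl[OF v] uv by auto
  then have "{?U, ?W} \<subseteq> V // r" "card {?U, ?W} = 2"
    using u v by (auto intro: quotientI)
  ultimately show ?thesis
    using card_mono[of "V // r" "{?U, ?W}"] card_Diff_subset[of "{?U, ?W}" "V // r"] by simp
qed

lemma card_partition_le_card_quotient:
  assumes V: "finite V" and r: "equiv V r" and P: "partition_on V P"
    and closed: "\<And>X a b. X \<in> P \<Longrightarrow> a \<in> X \<Longrightarrow> (a, b) \<in> r \<Longrightarrow> b \<in> X"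
  shows "card P \<le> card (V // r)"
proof -
  define pick where "pick X = (SOME a. a \<in> X)" for X :: "'a set"
  have pick: "pick X \<in> X" if "X \<in> P" for X
    using that P unfolding pick_def by (metis partition_onD3 ex_in_conv someI_ex)
  have inV: "pick X \<in> V" if "X \<in> P" for X using pick[OF that] that P partition_onD1 by blast
  have "inj_on (\<lambda>X. r `` {pick X}) P"
  proof (rule inj_onI)
    fix X Y assume XY: "X \<in> P" "Y \<in> P" "r `` {pick X} = r `` {pick Y}"
    then have "(pick X, pick Y) \<in> r" using eq_equiv_class[OF _ r] inV by metis
    then have "pick Y \<in> X \<inter> Y" using closed pick XY by blast
    then show "X = Y" using partition_onD2[OF P] XY by (auto simp: disjoint_def)
  qed
  moreover have "(\<lambda>X. r `` {pick X}) ` P \<subseteq> V // r" using inV by (auto intro: quotientI)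
  moreover have "finite (V // r)" using V r by (simp add: finite_quotient equiv_type)
  ultimately show ?thesis by (rule card_inj_on_le)
qed

section \<open>Counting connected components\<close>

context multigraph
begin

definition conn :: "'e set \<Rightarrow> ('v \<times> 'v) set" where
  "conn J = Restr ((adjacency J ends)\<^sup>*) V"

definition ncomp :: "'e set \<Rightarrow> nat" where
  "ncomp J = card (connected_components V J ends)"

lemma ncomp_conn: "ncomp J = card (V // conn J)"
  by (simp add: ncomp_def conn_def connected_components_def)

lemma sym_adjacency: "sym (adjacency J ends)"
  by (auto simp: sym_def adjacency_def insert_commute)

lemma equiv_conn: "equiv V (conn J)"
proof (rule equivI)
  show "conn J \<subseteq> V \<times> V" by (auto simp: conn_def)
  show "refl_on V (conn J)" by (auto simp: refl_on_def conn_def)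
  show "sym (conn J)"
    using sym_rtrancl[OF sym_adjacency, of J] by (auto simp: sym_def conn_def)
  show "trans (conn J)" by (auto simp: trans_def conn_def)
qed

lemma conn_mono: "A \<subseteq> B \<Longrightarrow> conn A \<subseteq> conn B"
  unfolding conn_def by (intro Int_mono rtrancl_mono) (auto simp: adjacency_def)

lemma ends_cases:
  assumes "e \<in> E"
  obtains u v where "ends e = {u, v}" "u \<in> V" "v \<in> V"
proof -
  have "\<exists>u v. ends e = {u, v}"
    using card_ends[OF assms] by (metis card_1_singletonE card_2_iff insert_absorb2)
  then show thesis using that ends_subset[OF assms] by blast
qed

lemma adjacency_insert:
  assumes "ends e = {u, v}"
  shows "adjacency (insert e J) ends = insert (u, v) (insert (v, u) (adjacency J ends))"
  using assms by (auto simp: adjacency_def doubleton_eq_iff)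

lemma conn_insert:
  assumes e: "ends e = {u, v}" and u: "u \<in> V" and v: "v \<in> V"
  shows "conn (insert e J) = conn J \<union> conn J `` {u} \<times> conn J `` {v} \<union> conn J `` {v} \<times> conn J `` {u}"
proof -
  define R where "R = (adjacency J ends)\<^sup>*"
  have sym: "(a, b) \<in> R \<longleftrightarrow> (b, a) \<in> R" for a b
    using sym_rtrancl[OF sym_adjacency, of J] by (auto simp: sym_def R_def)
  have trans: "(a, b) \<in> R \<Longrightarrow> (b, c) \<in> R \<Longrightarrow> (a, c) \<in> R" for a b c
    unfolding R_def by (rule rtrancl_trans)
  have refl: "(a, a) \<in> R" for a by (simp add: R_def)
  have "(a, b) \<in> (adjacency (insert e J) ends)\<^sup>* \<longleftrightarrow>
      (a, b) \<in> R \<or> (u, a) \<in> R \<and> (v, b) \<in> R \<or> (v, a) \<in> R \<and> (u, b) \<in> R" for a b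
    unfolding adjacency_insert[OF e] rtrancl_insert R_def[symmetric]
    using sym trans refl by (simp, blast)
  then show ?thesis
    using u v by (auto simp: conn_def R_def[symmetric])
qed

lemma conn_insert_connected:
  assumes "ends e = {u, v}" and "(u, v) \<in> conn J"
  shows "conn (insert e J) = conn J"
proof -
  have uv: "u \<in> V" "v \<in> V" using assms(2) by (auto simp: conn_def)
  have "conn J `` {u} = conn J `` {v}" by (rule equiv_class_eq[OF equiv_conn assms(2)])
  moreover have "conn J `` {v} \<times> conn J `` {v} \<subseteq> conn J"
    using equiv_conn[of J] unfolding equiv_def sym_def trans_def by blast
  ultimately have "conn J `` {u} \<times> conn J `` {v} \<subseteq> conn J" "conn J `` {v} \<times> conn J `` {u} \<subseteq> conn J"
    by simp_all
  then show ?thesis unfolding conn_insert[OF assms(1) uv] by auto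
qed

lemma ncomp_insert:
  assumes "ends e = {u, v}" and "u \<in> V" and "v \<in> V"
  shows "ncomp J = (if (u, v) \<in> conn J then ncomp (insert e J) else Suc (ncomp (insert e J)))"
proof (cases "(u, v) \<in> conn J")
  case True
  then show ?thesis using conn_insert_connected[OF assms(1) True] by (simp add: ncomp_conn)
next
  case False
  then show ?thesis
    using card_quotient_merge[OF finite_verts equiv_conn assms(2,3) False conn_insert[OF assms]]
    by (simp add: ncomp_conn)
qed

lemma ncomp_insert_bounds:
  assumes "e \<in> E"
  shows "ncomp (insert e J) \<le> ncomp J" and "ncomp J \<le> Suc (ncomp (insert e J))"
proof -
  obtain u v where e: "ends e = {u, v}" "u \<in> V" "v \<in> V" using ends_cases[OF assms] .
  show "ncomp (insert e J) \<le> ncomp J" "ncomp J \<le> Suc (ncomp (insert e J))"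
    using ncomp_insert[OF e, of J] by (auto split: if_splits)
qed

lemma ncomp_Un_bounds:
  assumes "finite A" and "A \<subseteq> E"
  shows "ncomp (J \<union> A) \<le> ncomp J \<and> ncomp J \<le> ncomp (J \<union> A) + card A"
  using assms
proof (induction A)
  case (insert e A)
  then show ?case using ncomp_insert_bounds[of e "J \<union> A"] by simp
qed simp

lemma ncomp_antimono:
  assumes "A \<subseteq> B" and "B \<subseteq> E"
  shows "ncomp B \<le> ncomp A"
proof -
  have "finite B" using assms(2) finite_edges finite_subset by blast
  then have "ncomp (A \<union> B) \<le> ncomp A" using ncomp_Un_bounds assms(2) by blast
  then show ?thesis using assms(1) by (simp add: Un_absorb1)
qed

lemma ncomp_empty: "ncomp {} = card V"
proof -
  have "conn {} = Id_on V" by (auto simp: conn_def adjacency_def)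
  then have "V // conn {} = (\<lambda>v. {v}) ` V" by (auto simp: quotient_def)
  then show ?thesis by (simp add: ncomp_conn card_image)
qed

lemma ncomp_le_card:
  assumes "J \<subseteq> E"
  shows "ncomp J \<le> card V"
  using ncomp_antimono[of "{}" J] assms by (simp add: ncomp_empty)

text \<open>
  Adding edges one at a time, each edge that merges two components of the larger graph
  \<open>(V, B)\<close> also merges two components of the smaller graph \<open>(V, A)\<close>.
\<close>

lemma ncomp_diminishing:
  assumes "finite C" and "C \<subseteq> E" and "A \<subseteq> B"
  shows "ncomp B + ncomp (A \<union> C) \<le> ncomp (B \<union> C) + ncomp A"
  using assms
proof (induction C)
  case (insert e C)
  obtain u v where e: "ends e = {u, v}" "u \<in> V" "v \<in> V" using ends_cases insert.prems by blast
  have "conn (A \<union> C) \<subseteq> conn (B \<union> C)" using insert.prems by (intro conn_mono) auto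
  then show ?case
    using insert ncomp_insert[OF e, of "A \<union> C"] ncomp_insert[OF e, of "B \<union> C"]
    by (auto split: if_splits)
qed simp

lemma ncomp_supermodular:
  assumes "A \<subseteq> E" and "B \<subseteq> E"
  shows "ncomp A + ncomp B \<le> ncomp (A \<union> B) + ncomp (A \<inter> B)"
proof -
  have "finite B" using assms(2) finite_edges finite_subset by blast
  then have "ncomp A + ncomp ((A \<inter> B) \<union> B) \<le> ncomp (A \<union> B) + ncomp (A \<inter> B)"
    using assms by (intro ncomp_diminishing) auto
  then show ?thesis by (simp add: Un_absorb1)
qed

section \<open>Forests with a prescribed number of components\<close>

text \<open>
  The rest of the cycle is a walk from one end of its first edge to the other.  The index
  \<open>1 mod length es\<close> makes this walk empty for a loop.
\<close>

lemma cycle_edge_connected: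
  assumes cyc: "is_cycle F ends vs es" and "F \<subseteq> E"
  obtains e u v where "e \<in> F" "ends e = {u, v}" "(u, v) \<in> conn (F - {e})"
proof -
  let ?n = "length es" and ?e = "es ! 0"
  have n: "?n > 0" and dist: "distinct es" and sub: "set es \<subseteq> F"
    and step: "\<And>i. i < ?n \<Longrightarrow> ends (es ! i) = {vs ! i, vs ! (Suc i mod ?n)}"
    using cyc by (auto simp: is_cycle_def)
  have walk: "(vs ! (1 mod ?n), vs ! (Suc j mod ?n)) \<in> (adjacency (F - {?e}) ends)\<^sup>*" if "j < ?n" for j
    using that
  proof (induction j)
    case (Suc j)
    have "es ! Suc j \<noteq> ?e" using dist Suc.prems n by (simp add: nth_eq_iff_index_eq)
    then have "es ! Suc j \<in> F - {?e}" using sub Suc.prems nth_mem by blast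
    then have "(vs ! (Suc j mod ?n), vs ! (Suc (Suc j) mod ?n)) \<in> adjacency (F - {?e}) ends"
      using step[OF Suc.prems] Suc.prems by (auto simp: adjacency_def)
    then show ?case using Suc by (meson Suc_lessD rtrancl.rtrancl_into_rtrancl)
  qed simp
  have "?e \<in> F" using sub n by auto
  have ends: "ends ?e = {vs ! (1 mod ?n), vs ! 0}" using step[OF n] by (simp add: insert_commute)
  then have "vs ! (1 mod ?n) \<in> V" "vs ! 0 \<in> V"
    using ends_subset[of ?e] \<open>?e \<in> F\<close> \<open>F \<subseteq> E\<close> by auto
  then have "(vs ! (1 mod ?n), vs ! 0) \<in> conn (F - {?e})"
    using walk[of "?n - 1"] n by (simp add: conn_def)
  then show thesis using that[OF \<open>?e \<in> F\<close> ends] by blast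
qed

text \<open>
  The forest is a minimal subset of \<open>J\<close> with at most \<open>m\<close> components, so removing any of its edges
  gives more than \<open>m\<close> components.  The bound \<open>m \<le> card V\<close> covers the case that the minimal set is
  empty and there is no edge to remove.
\<close>

lemma spanning_forest_with_components:
  assumes J: "J \<subseteq> E" "ncomp J \<le> m" and m: "m \<le> card V"
  obtains F where "F \<subseteq> J" "spanning_forest E ends F" "ncomp F = m"
proof -
  let ?\<F> = "{F. F \<subseteq> J \<and> ncomp F \<le> m}"
  have "finite J" using J(1) finite_edges finite_subset by blast
  then have "finite ?\<F>" by (auto intro: finite_subset[of _ "Pow J"])
  moreover have "J \<in> ?\<F>" using J by simp
  ultimately obtain F where F_min: "F \<in> ?\<F>" "\<forall>F'\<in>?\<F>. F' \<subseteq> F \<longrightarrow> F = F'"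
    using finite_has_minimal[of ?\<F>] by blast
  then have F: "F \<subseteq> J" "ncomp F \<le> m" by simp_all
  have min: "F' = F" if "F' \<subseteq> J" "ncomp F' \<le> m" "F' \<subseteq> F" for F'
    using F_min(2) that by blast
  have FE: "F \<subseteq> E" using F J by auto
  have removal: "m < ncomp (F - {e})" if "e \<in> F" for e
    using min[of "F - {e}"] F that by (auto simp: not_le[symmetric])
  have "\<not> is_cycle F ends vs es" for vs es
  proof
    assume "is_cycle F ends vs es"
    then obtain e u v where e: "e \<in> F" "ends e = {u, v}" "(u, v) \<in> conn (F - {e})"
      using cycle_edge_connected FE by blast
    then have "conn F = conn (F - {e})"
      using conn_insert_connected[OF e(2,3)] by (simp add: insert_absorb)
    then show False using removal[OF e(1)] F(2) by (simp add: ncomp_conn)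
  qed
  moreover have "ncomp F = m"
  proof (cases "F = {}")
    case True
    then show ?thesis using F(2) m by (simp add: ncomp_empty)
  next
    case False
    then obtain e where "e \<in> F" by auto
    then show ?thesis
      using removal[of e] ncomp_insert_bounds(2)[of e "F - {e}"] F(2) FE
      by (auto simp: insert_absorb)
  qed
  ultimately show thesis using that F(1) FE by (auto simp: spanning_forest_def)
qed

section \<open>Edges entering a partition\<close>

definition entering :: "'v set set \<Rightarrow> 'e set" where
  "entering P = {e \<in> E. \<exists>X\<in>P. enters ends e X}"

lemma num_entering_entering: "num_entering E ends P = card (entering P)"
  by (simp add: num_entering_def entering_def)

lemma card_partition_le_ncomp:
  assumes P: "partition_on V P" and J: "J \<subseteq> E" "J \<inter> entering P = {}"
  shows "card P \<le> ncomp J"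
  unfolding ncomp_conn
proof (rule card_partition_le_card_quotient[OF finite_verts equiv_conn P])
  fix X a b assume X: "X \<in> P" "a \<in> X" "(a, b) \<in> conn J"
  from X(3) have "(a, b) \<in> (adjacency J ends)\<^sup>*" by (simp add: conn_def)
  then show "b \<in> X"
  proof induction
    case (step b c)
    then obtain e where e: "e \<in> J" "ends e = {b, c}" by (auto simp: adjacency_def)
    then have "e \<in> E" "e \<notin> entering P" using J by auto
    then show ?case using step.IH e(2) X(1) unfolding entering_def enters_def by blast
  qed (use X in simp)
qed

lemma card_partition_le_ncomp_entering:
  assumes P: "partition_on V P" and F: "F \<subseteq> E"
  shows "card P \<le> ncomp F + card (F \<inter> entering P)"
proof -
  have "finite F" using F finite_edges finite_subset by blast
  then have "ncomp (F - entering P) \<le> ncomp ((F - entering P) \<union> (F \<inter> entering P)) + card (F \<inter> entering P)"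
    using F by (intro ncomp_Un_bounds[THEN conjunct2]) auto
  moreover have "(F - entering P) \<union> (F \<inter> entering P) = F" by auto
  moreover have "card P \<le> ncomp (F - entering P)"
    using P F by (intro card_partition_le_ncomp) auto
  ultimately show ?thesis by simp
qed

lemma entering_components:
  assumes "J \<subseteq> E"
  shows "entering (V // conn J) \<subseteq> E - J"
proof
  fix e assume "e \<in> entering (V // conn J)"
  then obtain X u v where e: "e \<in> E" "X \<in> V // conn J" "ends e = {u, v}" "u \<in> X" "v \<notin> X"
    by (auto simp: entering_def enters_def)
  have "e \<notin> J"
  proof
    assume "e \<in> J"
    then have "(u, v) \<in> conn J"
      using e ends_subset[OF e(1)] by (auto simp: conn_def adjacency_def)
    then show False using e(2,4,5) equiv_conn in_quotient_imp_closed by metis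
  qed
  with e(1) show "e \<in> E - J" by simp
qed

lemma packing_imp_partition_condition:
  assumes F: "\<And>i. i \<in> I \<Longrightarrow> F i \<subseteq> E \<and> ncomp (F i) = l i"
    and disj: "disjoint_family_on F I" and I: "finite I" and P: "partition_on V P"
  shows "card I * card P \<le> (\<Sum>i\<in>I. min (l i) (card P)) + num_entering E ends P"
proof -
  have fin: "finite (entering P)" using finite_edges by (simp add: entering_def)
  have "card P \<le> min (l i) (card P) + card (F i \<inter> entering P)" if "i \<in> I" for i
    using card_partition_le_ncomp_entering[OF P, of "F i"] F[OF that] by simp
  then have "(\<Sum>i\<in>I. card P) \<le> (\<Sum>i\<in>I. min (l i) (card P) + card (F i \<inter> entering P))"
    by (rule sum_mono)
  moreover have "(\<Sum>i\<in>I. card (F i \<inter> entering P)) = card (\<Union>i\<in>I. F i \<inter> entering P)"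
    using disj I fin by (intro card_UN_disjoint[symmetric]) (auto simp: disjoint_family_on_def)
  moreover have "card (\<Union>i\<in>I. F i \<inter> entering P) \<le> card (entering P)"
    using fin by (intro card_mono) auto
  ultimately show ?thesis by (simp add: sum.distrib num_entering_entering)
qed

lemma partition_condition_imp_packing:
  assumes I: "finite I" and l: "\<And>i. i \<in> I \<Longrightarrow> l i \<le> card V"
    and cond: "\<And>P. partition_on V P \<Longrightarrow>
      card I * card P \<le> (\<Sum>i\<in>I. min (l i) (card P)) + num_entering E ends P"
  obtains F where "\<And>i. i \<in> I \<Longrightarrow> spanning_forest E ends (F i) \<and> ncomp (F i) = l i"
    and "disjoint_family_on F I"
proof -
  define f where "f i J = - max (int (l i)) (int (ncomp J))" for i J
  have rado: "int (card J) \<le> (\<Sum>i\<in>I. f i J) + (int (card E) + (\<Sum>i\<in>I. int (l i)))"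
    if J: "J \<subseteq> E" for J
  proof -
    have "card (entering (V // conn J)) \<le> card (E - J)"
      using finite_edges by (intro card_mono entering_components J) auto
    also have "\<dots> = card E - card J"
      using J finite_edges finite_subset by (intro card_Diff_subset) auto
    finally have ent: "int (card (entering (V // conn J))) \<le> int (card E) - int (card J)"
      using card_mono[OF finite_edges J] by linarith
    have "int (card I * ncomp J)
        \<le> int ((\<Sum>i\<in>I. min (l i) (ncomp J)) + card (entering (V // conn J)))"
      using cond[OF partition_on_quotient[OF equiv_conn]]
      unfolding num_entering_entering ncomp_conn[symmetric] of_nat_le_iff .
    \<comment> \<open>The sum of the minimum and the maximum of two numbers is the sum of the two numbers.\<close>
    moreover have "(\<Sum>i\<in>I. int (min (l i) (ncomp J)))
        = (\<Sum>i\<in>I. f i J + int (l i) + int (ncomp J))"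
      by (intro sum.cong) (auto simp: f_def)
    ultimately show ?thesis using ent by (simp add: sum.distrib)
  qed
  have f_mono: "f i A \<le> f i B" if "A \<subseteq> B" "B \<subseteq> E" for i A B
    using ncomp_antimono[OF that] by (auto simp: f_def)
  have f_submod: "f i (A \<union> B) + f i (A \<inter> B) \<le> f i A + f i B" if "A \<subseteq> E" "B \<subseteq> E" for i A B
    unfolding f_def
    using supermodular_max[of "int (ncomp A)" "int (ncomp B)" "int (ncomp (A \<union> B))"
        "int (ncomp (A \<inter> B))" "int (l i)"]
      ncomp_supermodular[OF that] that
      ncomp_antimono[of A "A \<union> B"] ncomp_antimono[of B "A \<union> B"]
      ncomp_antimono[of "A \<inter> B" A] ncomp_antimono[of "A \<inter> B" B]
    by auto
  obtain C where C: "\<forall>i. C i \<subseteq> E" "disjoint_family_on C I"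
    and sum: "int (card E) \<le> (\<Sum>i\<in>I. f i (C i)) + (int (card E) + (\<Sum>i\<in>I. int (l i)))"
    using submodular_colouring[of E I f, OF finite_edges I f_mono f_submod rado] by blast
  \<comment> \<open>No summand of the following sum is negative, so the upper bound on the sum makes each of
    them zero.\<close>
  have "(\<Sum>i\<in>I. - f i (C i) - int (l i)) \<le> 0" using sum by (simp add: sum_subtractf sum_negf)
  moreover have nonneg: "0 \<le> - f i (C i) - int (l i)" for i by (simp add: f_def)
  ultimately have "\<forall>i\<in>I. - f i (C i) - int (l i) = 0"
    using sum_nonneg_eq_0_iff[OF I, of "\<lambda>i. - f i (C i) - int (l i)"]
      sum_nonneg[of I "\<lambda>i. - f i (C i) - int (l i)"] by force
  then have "ncomp (C i) \<le> l i" if "i \<in> I" for i using that by (auto simp: f_def)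
  then have "\<exists>F. F \<subseteq> C i \<and> spanning_forest E ends F \<and> ncomp F = l i" if "i \<in> I" for i
    using spanning_forest_with_components[OF C(1)[rule_format]] l that by metis
  then obtain F where F: "\<And>i. i \<in> I \<Longrightarrow> F i \<subseteq> C i \<and> spanning_forest E ends (F i) \<and> ncomp (F i) = l i"
    by metis
  have "disjoint_family_on F I"
    using C(2) F unfolding disjoint_family_on_def by blast
  then show thesis using that F by blast
qed

end

section \<open>The characterization\<close>

theorem theorem13:
  fixes V :: "'v set" and E :: "'e set" and ends :: "'e \<Rightarrow> 'v set"
    and k :: nat and l :: "nat \<Rightarrow> nat"
  assumes "multigraph V E ends"
    and "k > 0"
    and "\<forall>i\<in>{1..k}. l i > 0"
  shows "(\<exists>F. forest_packing V E ends k l F) \<longleftrightarrow>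
    (\<forall>i\<in>{1..k}. card V \<ge> l i) \<and>
    (\<forall>P. partition_on V P \<longrightarrow>
       (\<Sum>i=1..k. min (l i) (card P)) + num_entering E ends P \<ge> k * card P)"
proof -
  interpret multigraph V E ends by fact
  show ?thesis
  proof (intro iffI conjI ballI allI impI)
    assume "\<exists>F. forest_packing V E ends k l F"
    then obtain F where F: "\<And>i. i \<in> {1..k} \<Longrightarrow> F i \<subseteq> E \<and> ncomp (F i) = l i"
      and disj: "disjoint_family_on F {1..k}"
      unfolding forest_packing_def spanning_forest_def ncomp_def by blast
    show "l i \<le> card V" if "i \<in> {1..k}" for i
      using F[OF that] ncomp_le_card by metis
    show "k * card P \<le> (\<Sum>i=1..k. min (l i) (card P)) + num_entering E ends P"
      if "partition_on V P" for P
      using packing_imp_partition_condition[OF F disj _ that] by simp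
  next
    assume "(\<forall>i\<in>{1..k}. l i \<le> card V) \<and>
      (\<forall>P. partition_on V P \<longrightarrow>
         k * card P \<le> (\<Sum>i=1..k. min (l i) (card P)) + num_entering E ends P)"
    then obtain F where "\<And>i. i \<in> {1..k} \<Longrightarrow> spanning_forest E ends (F i) \<and> ncomp (F i) = l i"
      and "disjoint_family_on F {1..k}"
      using partition_condition_imp_packing[of "{1..k}" l] by auto
    then show "\<exists>F. forest_packing V E ends k l F"
      unfolding forest_packing_def ncomp_def by blast
  qed
qed

end
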